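(* Any streaming algorithm for \textsc{Diameter} in the AL model that works on a family of graphs including all split graphs and uses $p$ passes over the stream requires $\Omega(n/p)$ bits of memory on $n$-vertex graphs.
   Context: A split graph is a graph whose vertex set can be partitioned into a clique and an independent set. \textsc{Diameter}: compute $\max_{s,t} d(s,t)$ (shortest-path distance). In the Adjacency List (AL) streaming model the graph arrives as a sequence of vertices in arbitrary fixed order, each with the full list of its incident edges (each edge appears twice). A $p$-pass algorithm reads the sequence $p$ times with unlimited computation; memory is in bits. "Requires $\Omega(f)$ bits" means there is a constant $c>0$ such that every such algorithm uses at least $c f$ bits on some $n$-vertex input of the class, for all sufficiently large $n$ and all $p$. *)

theory Defs
  imports "Graph_Theory.Graph_Theory"
begin

text \<open>
  A finite simple graph is a \<^locale>\<open>pair_graph\<close>: every undirected edge is represented by its two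
  opposite arcs.
\<close>

definition split_graph :: "'a pair_pre_digraph \<Rightarrow> bool" where
  "split_graph G \<longleftrightarrow> pair_graph G \<and>
     (\<exists>K I. pverts G = K \<union> I \<and> K \<inter> I = {} \<and>
        (\<forall>u\<in>K. \<forall>v\<in>K. u \<noteq> v \<longrightarrow> (u, v) \<in> parcs G) \<and>
        (\<forall>u\<in>I. \<forall>v\<in>I. (u, v) \<notin> parcs G))"

text \<open>The distance, and hence the diameter, is \<open>\<infinity>\<close> between different components.\<close>

definition graph_dist :: "'a pair_pre_digraph \<Rightarrow> 'a \<Rightarrow> 'a \<Rightarrow> ereal" where
  "graph_dist G s t = wf_digraph.\<mu> (with_proj G) (\<lambda>_. 1) s t"

definition graph_diameter :: "'a pair_pre_digraph \<Rightarrow> ereal" where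
  "graph_diameter G = Max {graph_dist G s t | s t. s \<in> pverts G \<and> t \<in> pverts G}"

text \<open>
  One item of an adjacency list stream is a vertex together with the list of all its incident edges,
  written as arcs leaving that vertex. The order of the vertices and the order inside each list are
  arbitrary.
\<close>

type_synonym al_item = "nat \<times> (nat \<times> nat) list"

definition al_stream :: "nat pair_pre_digraph \<Rightarrow> al_item list \<Rightarrow> bool" where
  "al_stream G \<sigma> \<longleftrightarrow> distinct (map fst \<sigma>) \<and> set (map fst \<sigma>) = pverts G \<and>
     (\<forall>(v, es) \<in> set \<sigma>. distinct es \<and> set es = out_arcs (with_proj G) v)"

text \<open>
  The memory is a bit string. The update function is arbitrary (unlimited computation). Its first
  argument is the number of items read so far over all passes, so that the current pass and the
  position in it need not be kept in memory. Memory is measured between items.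
\<close>

record stream_alg =
  initial :: "bool list"
  update :: "nat \<Rightarrow> bool list \<Rightarrow> al_item \<Rightarrow> bool list"
  result :: "bool list \<Rightarrow> ereal"

primrec memory_at :: "stream_alg \<Rightarrow> al_item list \<Rightarrow> nat \<Rightarrow> bool list" where
  "memory_at A \<sigma> 0 = initial A"
| "memory_at A \<sigma> (Suc t) = update A t (memory_at A \<sigma> t) (\<sigma> ! (t mod length \<sigma>))"

text \<open>In the next two definitions \<open>p\<close> is the number of passes over \<open>\<sigma>\<close>.\<close>

definition alg_output :: "stream_alg \<Rightarrow> nat \<Rightarrow> al_item list \<Rightarrow> ereal" where
  "alg_output A p \<sigma> = result A (memory_at A \<sigma> (p * length \<sigma>))"

definition memory_used :: "stream_alg \<Rightarrow> nat \<Rightarrow> al_item list \<Rightarrow> nat" where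
  "memory_used A p \<sigma> = Max {length (memory_at A \<sigma> t) | t. t \<le> p * length \<sigma>}"

text \<open>
  The vertices of an \<open>n\<close>-vertex input are labelled \<open>0, \<dots>, n - 1\<close>, and \<open>A\<close> may depend on \<open>n\<close>.
\<close>

definition solves_diameter ::
    "stream_alg \<Rightarrow> nat \<Rightarrow> nat pair_pre_digraph set \<Rightarrow> nat \<Rightarrow> bool" where
  "solves_diameter A p \<F> n \<longleftrightarrow>
     (\<forall>G\<in>\<F>. pverts G = {..<n} \<longrightarrow>
        (\<forall>\<sigma>. al_stream G \<sigma> \<longrightarrow> alg_output A p \<sigma> = graph_diameter G))"

end

theory Submission
  imports Defs
begin

text \<open>
  Lower bound by a fooling set for set disjointness. The first player holds the lists of the vertices
  \<open>0, \<dots>, m\<close>, which depend only on \<open>X\<close>, the second player all other lists, which depend only on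
  \<open>Y\<close>. The gadget below is a split graph whose diameter is at most 2 if and only if
  \<open>X \<union> Y\<close> covers \<open>{1..m}\<close>. On the inputs \<open>(S, - S)\<close> the diameter is at most 2,
  while for \<open>S \<noteq> T\<close> one of \<open>(S, - T)\<close> and \<open>(T, - S)\<close> has larger diameter. Hence the
  memory contents at the \<open>2p\<close> moments when the stream passes from one player to the other
  determine \<open>S\<close>, and there are \<open>2\<^sup>m\<close> choices of \<open>S\<close>.
\<close>

section \<open>Multi-pass algorithms on glued streams\<close>

lemma memory_at_cong:
  assumes "memory_at A \<sigma> s = memory_at A \<tau> s"
    and "\<And>i. i < d \<Longrightarrow> \<sigma> ! ((s + i) mod length \<sigma>) = \<tau> ! ((s + i) mod length \<tau>)"
  shows "memory_at A \<sigma> (s + d) = memory_at A \<tau> (s + d)"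
  using assms by (induction d) auto

text \<open>Cut and paste, by induction on passes: the glued run follows \<open>\<tau>\<close> for
  the first \<open>h\<close> items, may be regarded as a run on \<open>\<tau>'\<close> from there
  because the memories agree, and is back on \<open>\<tau>\<close> at the end of the pass for the
  same reason.\<close>

lemma memory_at_glue:
  fixes h :: nat
  assumes "length \<tau> = n" "length \<tau>' = n" "h \<le> n"
    and "\<And>k. k < p \<Longrightarrow> memory_at A \<tau> (k * n + h) = memory_at A \<tau>' (k * n + h)"
    and "\<And>k. k < p \<Longrightarrow> memory_at A \<tau> (k * n + n) = memory_at A \<tau>' (k * n + n)"
    and "k \<le> p"
  shows "memory_at A (take h \<tau> @ drop h \<tau>') (k * n) = memory_at A \<tau> (k * n)"
  using \<open>k \<le> p\<close>
proof (induction k)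
  case (Suc k)
  let ?\<sigma> = "take h \<tau> @ drop h \<tau>'"
  have len: "length ?\<sigma> = n"
    using assms(1-3) by simp
  have "memory_at A ?\<sigma> (k * n + h) = memory_at A \<tau> (k * n + h)"
    using Suc assms(1-3) len by (intro memory_at_cong) (auto simp: nth_append)
  also have "\<dots> = memory_at A \<tau>' (k * n + h)"
    using assms(4) Suc.prems by simp
  finally have "memory_at A ?\<sigma> (k * n + h + (n - h)) = memory_at A \<tau>' (k * n + h + (n - h))"
    using assms(1-3) len
    by (intro memory_at_cong[where s = "k * n + h" and d = "n - h"])
      (auto simp: nth_append add.assoc)
  then show ?case
    using assms(3) assms(5)[of k] Suc.prems by (simp add: add.commute)
qed simp

lemma length_memory_at_le_memory_used:
  assumes "t \<le> p * length \<sigma>"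
  shows "length (memory_at A \<sigma> t) \<le> memory_used A p \<sigma>"
proof -
  have "finite {length (memory_at A \<sigma> t) | t. t \<le> p * length \<sigma>}"
    by simp
  then show ?thesis
    using assms unfolding memory_used_def by (intro Max_ge) auto
qed

text \<open>The exact count is \<open>2 ^ (M + 1) - 1\<close>; the cruder \<open>4 ^ M\<close> has
  an exponent linear in \<open>M\<close> and is still valid for \<open>M = 0\<close>.\<close>

lemma card_bool_lists_length_le:
  "finite {b :: bool list. length b \<le> M}" "card {b :: bool list. length b \<le> M} \<le> 4 ^ M"
proof -
  have eq: "{b :: bool list. length b \<le> M} = {b. set b \<subseteq> UNIV \<and> length b \<le> M}"
    by simp
  show "finite {b :: bool list. length b \<le> M}"
    unfolding eq by (rule finite_lists_length_le) simp
  have "(\<Sum>i\<le>M. 2 ^ i) \<le> (4 :: nat) ^ M"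
  proof (induction M)
    case (Suc M)
    have "(2 :: nat) ^ M \<le> 4 ^ M"
      by (rule power_mono) auto
    with Suc show ?case by simp
  qed simp
  then show "card {b :: bool list. length b \<le> M} \<le> 4 ^ M"
    unfolding eq by (subst card_lists_length_le) auto
qed

text \<open>The transcript \<open>f x\<close> lists the memory at both handovers of each pass. Equal
  transcripts for \<open>x\<close> and \<open>y\<close> would give both glued streams the outputs
  excluded by the last assumption, so \<open>f\<close> is injective on \<open>F\<close>, and there
  are at most \<open>(4 ^ M * 4 ^ M) ^ p\<close> transcripts.\<close>

lemma card_fooling_set_le:
  fixes \<tau> :: "'a \<Rightarrow> al_item list" and h :: nat
  assumes len: "\<And>x. x \<in> F \<Longrightarrow> length (\<tau> x) = n" and "h \<le> n"
    and mem: "\<And>x t. x \<in> F \<Longrightarrow> t \<le> p * n \<Longrightarrow> length (memory_at A (\<tau> x) t) \<le> M"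
    and fool: "\<And>x y. x \<in> F \<Longrightarrow> y \<in> F \<Longrightarrow> x \<noteq> y \<Longrightarrow>
      alg_output A p (take h (\<tau> x) @ drop h (\<tau> y)) \<noteq> alg_output A p (\<tau> y) \<or>
      alg_output A p (take h (\<tau> y) @ drop h (\<tau> x)) \<noteq> alg_output A p (\<tau> x)"
  shows "card F \<le> 16 ^ (M * p)"
proof -
  define L where "L = {b :: bool list. length b \<le> M}"
  define f where "f x = map (\<lambda>k. (memory_at A (\<tau> x) (k * n + h), memory_at A (\<tau> x) (k * n + n)))
    [0..<p]" for x
  let ?T = "{ys. set ys \<subseteq> L \<times> L \<and> length ys = p}"
  have out: "alg_output A p (take h (\<tau> x) @ drop h (\<tau> y)) = alg_output A p (\<tau> y)"
    if "x \<in> F" "y \<in> F" "f x = f y" for x y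
  proof -
    have eq: "memory_at A (\<tau> x) (k * n + h) = memory_at A (\<tau> y) (k * n + h)"
      "memory_at A (\<tau> x) (k * n + n) = memory_at A (\<tau> y) (k * n + n)" if "k < p" for k
      using \<open>f x = f y\<close> that by (auto simp: f_def)
    have "memory_at A (take h (\<tau> x) @ drop h (\<tau> y)) (p * n) = memory_at A (\<tau> x) (p * n)"
      using len that eq \<open>h \<le> n\<close> by (intro memory_at_glue[where p = p]) auto
    also have "\<dots> = memory_at A (\<tau> y) (p * n)"
      \<comment> \<open>For \<open>p = 0\<close> both sides are the initial memory; otherwise this
        is the handover that ends the last pass.\<close>
      using eq(2)[of "p - 1"] by (cases p) (auto simp: add.commute)
    finally show ?thesis
      using len that \<open>h \<le> n\<close> by (simp add: alg_output_def)
  qed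
  have "inj_on f F"
    using out fool by (metis inj_onI)
  moreover have "f ` F \<subseteq> ?T"
  proof -
    have "k * n + n \<le> p * n" if "k < p" for k
      using mult_le_mono1[of "Suc k" p n] that by simp
    then have "k * n + h \<le> p * n" "k * n + n \<le> p * n" if "k < p" for k
      using that \<open>h \<le> n\<close> by (meson add_left_mono le_trans)+
    then show ?thesis
      using mem by (auto simp: f_def L_def)
  qed
  moreover have fin: "finite (L \<times> L)"
    using card_bool_lists_length_le(1) by (simp add: L_def)
  ultimately have "card F \<le> card ?T"
    by (intro card_inj_on_le finite_lists_length_eq)
  also have "\<dots> = (card L * card L) ^ p"
    using fin by (simp add: card_lists_length_eq card_cartesian_product)
  also have "\<dots> \<le> (4 ^ M * 4 ^ M) ^ p"
    using card_bool_lists_length_le(2)[of M] by (intro power_mono mult_mono) (auto simp: L_def)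
  also have "\<dots> = 16 ^ (M * p)"
    by (simp add: power_mult flip: power_mult_distrib)
  finally show ?thesis .
qed

section \<open>Diameter at most two\<close>

text \<open>Letting \<open>w\<close> coincide with \<open>u\<close> or \<open>v\<close> treats
  distances 0, 1 and 2 uniformly.\<close>

lemma graph_diameter_le_2:
  assumes "pair_graph G" "pverts G \<noteq> {}"
    and "\<And>u v. u \<in> pverts G \<Longrightarrow> v \<in> pverts G \<Longrightarrow>
      \<exists>w\<in>pverts G. (u = w \<or> (u, w) \<in> parcs G) \<and> (w = v \<or> (w, v) \<in> parcs G)"
  shows "graph_diameter G \<le> 2"
proof -
  interpret pair_graph G by fact
  have dist: "graph_dist G u v \<le> 2" if "u \<in> pverts G" "v \<in> pverts G" for u v
  proof -
    from assms(3)[OF that] obtain w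
      where w: "w \<in> pverts G" "u = w \<or> (u, w) \<in> parcs G" "w = v \<or> (w, v) \<in> parcs G"
      by blast
    define q where "q = (if u = w then [] else [(u, w)]) @ (if w = v then [] else [(w, v)])"
    have "awalk u q v"
      using w that by (auto simp: q_def awalk_simps)
    then have "graph_dist G u v \<le> ereal (awalk_cost (\<lambda>_. 1) q)"
      unfolding graph_dist_def by (rule min_cost_le_walk_cost)
    also have "\<dots> \<le> 2"
      by (simp add: q_def)
    finally show ?thesis .
  qed
  have eq: "{graph_dist G s t | s t. s \<in> pverts G \<and> t \<in> pverts G}
      = (\<lambda>(s, t). graph_dist G s t) ` (pverts G \<times> pverts G)"
    by auto
  show ?thesis
    unfolding graph_diameter_def eq
    using assms(2) dist pair_finite_verts by (subst Max_le_iff) auto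
qed

text \<open>Every walk from \<open>s\<close> to \<open>t\<close> has at least 3 arcs. If there is no
  walk, the infimum is infinite and the bound holds as well.\<close>

lemma graph_diameter_gt_2:
  assumes "pair_graph G" "s \<in> pverts G" "t \<in> pverts G" "s \<noteq> t" "(s, t) \<notin> parcs G"
    and "\<And>w. (s, w) \<in> parcs G \<Longrightarrow> (w, t) \<notin> parcs G"
  shows "graph_diameter G > 2"
proof -
  interpret pair_graph G by fact
  have "ereal 3 \<le> ereal (awalk_cost (\<lambda>_. 1) q)" if "awalk s q t" for q
  proof -
    have "length q \<noteq> 0" "length q \<noteq> 1" "length q \<noteq> 2"
      using that assms(4-6) by (auto simp: awalk_simps length_Suc_conv numeral_2_eq_2)
    then have "3 \<le> length q"
      by linarith
    then show ?thesis
      by (simp add: awalk_cost_def sum_list_triv)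
  qed
  then have "ereal 3 \<le> graph_dist G s t"
    unfolding graph_dist_def \<mu>_def by (intro INF_greatest) auto
  moreover have "graph_dist G s t \<le> graph_diameter G"
  proof -
    have "{graph_dist G s t | s t. s \<in> pverts G \<and> t \<in> pverts G}
        = (\<lambda>(s, t). graph_dist G s t) ` (pverts G \<times> pverts G)"
      by auto
    then have "finite {graph_dist G s t | s t. s \<in> pverts G \<and> t \<in> pverts G}"
      using pair_finite_verts by simp
    then show ?thesis
      using assms(2,3) unfolding graph_diameter_def by (intro Max_ge) auto
  qed
  ultimately have "ereal 3 \<le> graph_diameter G"
    by (rule order_trans)
  moreover have "(2 :: ereal) < ereal 3"
    by simp
  ultimately show ?thesis
    by (rule order.strict_trans2[rotated])
qed

section \<open>The gadget\<close>

definition gadget_clique :: "nat \<Rightarrow> nat \<Rightarrow> nat set" where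
  "gadget_clique m n = {0, m + 1} \<union> {2 * m + 2..<n}"

text \<open>
  Edges between the clique and the independent set, for \<open>n \<ge> 3 m + 2\<close>. With \<open>i \<in> {1..m}\<close>, the
  independent set consists of \<open>a\<^sub>i = i\<close> and \<open>b\<^sub>i = m + 1 + i\<close>. The clique vertex
  \<open>0\<close> is joined to all \<open>b\<^sub>i\<close> and to \<open>a\<^sub>i\<close> for \<open>i \<in> X\<close>, the clique vertex \<open>m + 1\<close> to all
  \<open>a\<^sub>i\<close> and to \<open>b\<^sub>i\<close> for \<open>i \<in> Y\<close>, and the clique vertex \<open>2 m + 1 + i\<close> to \<open>a\<^sub>i\<close> and to \<open>b\<^sub>j\<close> for
  \<open>j \<noteq> i\<close>. The last kind brings \<open>a\<^sub>i\<close> and \<open>b\<^sub>j\<close> to distance 2 for all \<open>i \<noteq> j\<close>. The vertices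
  from \<open>3 m + 2\<close> on are padding.
\<close>

definition gadget_cross :: "nat \<Rightarrow> nat set \<Rightarrow> nat set \<Rightarrow> nat \<Rightarrow> nat \<Rightarrow> bool" where
  "gadget_cross m X Y u v \<longleftrightarrow>
     v \<in> {1..m} \<and> (u = 0 \<and> v \<in> X \<or> u = m + 1 \<or> u = 2 * m + 1 + v) \<or>
     v \<in> {m + 2..2 * m + 1} \<and>
       (u = 0 \<or> u = m + 1 \<and> v - (m + 1) \<in> Y \<or> u \<in> {2 * m + 2..3 * m + 1} \<and> u \<noteq> v + m)"

definition gadget_adj :: "nat \<Rightarrow> nat \<Rightarrow> nat set \<Rightarrow> nat set \<Rightarrow> nat \<Rightarrow> nat \<Rightarrow> bool" where
  "gadget_adj m n X Y u v \<longleftrightarrow>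
     u \<in> gadget_clique m n \<and> v \<in> gadget_clique m n \<and> u \<noteq> v \<or>
     gadget_cross m X Y u v \<or> gadget_cross m X Y v u"

definition gadget :: "nat \<Rightarrow> nat \<Rightarrow> nat set \<Rightarrow> nat set \<Rightarrow> nat pair_pre_digraph" where
  "gadget m n X Y = \<lparr>pverts = {..<n},
     parcs = {(u, v). u < n \<and> v < n \<and> gadget_adj m n X Y u v}\<rparr>"

definition gadget_stream :: "nat \<Rightarrow> nat \<Rightarrow> nat set \<Rightarrow> nat set \<Rightarrow> al_item list" where
  "gadget_stream m n X Y =
     map (\<lambda>u. (u, map (Pair u) (filter (gadget_adj m n X Y u) [0..<n]))) [0..<n]"

section \<open>Split structure and adjacency list stream of the gadget\<close>

lemma pverts_gadget [simp]: "pverts (gadget m n X Y) = {..<n}"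
  by (simp add: gadget_def)

lemma parcs_gadget [simp]:
  "(u, v) \<in> parcs (gadget m n X Y) \<longleftrightarrow> u < n \<and> v < n \<and> gadget_adj m n X Y u v"
  by (simp add: gadget_def)

lemma gadget_adj_sym: "gadget_adj m n X Y u v \<longleftrightarrow> gadget_adj m n X Y v u"
  by (auto simp: gadget_adj_def)

lemma gadget_adj_irrefl: "\<not> gadget_adj m n X Y u u"
  by (auto simp: gadget_adj_def gadget_cross_def)

lemma pair_graph_gadget: "pair_graph (gadget m n X Y)"
proof
  show "finite (parcs (gadget m n X Y))"
    by (rule finite_subset[of _ "{..<n} \<times> {..<n}"]) (auto simp: gadget_def)
  show "symmetric (with_proj (gadget m n X Y))"
    using gadget_adj_sym by (auto simp: symmetric_def intro!: symI)
qed (use gadget_adj_irrefl in \<open>auto simp: gadget_def\<close>)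

lemma split_graph_gadget:
  assumes "3 * m + 2 \<le> n"
  shows "split_graph (gadget m n X Y)"
  unfolding split_graph_def
proof (intro conjI exI)
  let ?K = "gadget_clique m n"
  show "pverts (gadget m n X Y) = ?K \<union> ({..<n} - ?K)"
    using assms by (auto simp: gadget_clique_def)
  show "\<forall>u\<in>?K. \<forall>v\<in>?K. u \<noteq> v \<longrightarrow> (u, v) \<in> parcs (gadget m n X Y)"
    using assms by (auto simp: gadget_adj_def) (auto simp: gadget_clique_def)
  have "gadget_cross m X Y u v \<Longrightarrow> u \<in> ?K" for u v
    using assms by (auto simp: gadget_cross_def gadget_clique_def)
  then show "\<forall>u\<in>{..<n} - ?K. \<forall>v\<in>{..<n} - ?K. (u, v) \<notin> parcs (gadget m n X Y)"
    by (auto simp: gadget_adj_def)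
qed (auto simp: pair_graph_gadget)

lemma al_stream_gadget: "al_stream (gadget m n X Y) (gadget_stream m n X Y)"
proof -
  have "map fst (gadget_stream m n X Y) = [0..<n]"
    by (simp add: gadget_stream_def comp_def)
  moreover have "distinct es \<and> set es = out_arcs (with_proj (gadget m n X Y)) u"
    if "(u, es) \<in> set (gadget_stream m n X Y)" for u es
    using that by (auto simp: gadget_stream_def out_arcs_def distinct_map inj_on_def)
  ultimately show ?thesis
    unfolding al_stream_def by auto
qed

lemma length_gadget_stream [simp]: "length (gadget_stream m n X Y) = n"
  by (simp add: gadget_stream_def)

text \<open>The labels are chosen for this. Edges depending on \<open>X\<close> join
  \<open>0\<close> to some \<open>a\<^sub>i\<close>, both at most \<open>m\<close>; edges depending
  on \<open>Y\<close> join \<open>m + 1\<close> to some \<open>b\<^sub>i\<close>, both above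
  \<open>m\<close>. So both copies of such an edge lie on the same side of the cut.\<close>

lemma gadget_stream_glue:
  "take (m + 1) (gadget_stream m n X Y) @ drop (m + 1) (gadget_stream m n X' Y')
    = gadget_stream m n X Y'"
proof (rule nth_equalityI)
  fix u
  assume "u < length (take (m + 1) (gadget_stream m n X Y) @
    drop (m + 1) (gadget_stream m n X' Y'))"
  then have "u < n"
    by auto
  have "gadget_adj m n X Y u = gadget_adj m n X Y' u" if "u \<le> m"
    using that by (auto simp: gadget_adj_def gadget_cross_def fun_eq_iff)
  moreover have "gadget_adj m n X' Y' u = gadget_adj m n X Y' u" if "u > m"
    using that by (auto simp: gadget_adj_def gadget_cross_def fun_eq_iff)
  ultimately show "(take (m + 1) (gadget_stream m n X Y) @
      drop (m + 1) (gadget_stream m n X' Y')) ! u = gadget_stream m n X Y' ! u"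
    using \<open>u < n\<close> by (auto simp: nth_append gadget_stream_def min_def)
qed auto

section \<open>Diameter of the gadget\<close>

lemma gadget_diameter_le_2:
  assumes n: "3 * m + 2 \<le> n" and cover: "{1..m} \<subseteq> X \<union> Y"
  shows "graph_diameter (gadget m n X Y) \<le> 2"
proof (rule graph_diameter_le_2)
  define K where "K = gadget_clique m n"
  let ?E = "\<lambda>u v. u = v \<or> gadget_adj m n X Y u v"
  let ?P = "\<lambda>u v. \<exists>w<n. ?E u w \<and> ?E w v"
  have E_sym: "?E u v \<Longrightarrow> ?E v u" for u v
    using gadget_adj_sym[of m n X Y u v] by blast
  have P_sym: "?P v u" if "?P u v" for u v
  proof -
    from that obtain w where "w < n" "?E u w" "?E w v"
      by blast
    with E_sym[of u w] E_sym[of w v] show ?thesis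
      by (intro exI[of _ w] conjI)
  qed
  have KK: "?E u v" if "u \<in> K" "v \<in> K" for u v
    using that by (auto simp: K_def gadget_adj_def)
  have K: "0 \<in> K" "m + 1 \<in> K" "K \<subseteq> {..<n}"
    using n by (auto simp: K_def gadget_clique_def)
  have a: "?E (m + 1) i" if "i \<in> {1..m}" for i
    using that by (auto simp: gadget_adj_def gadget_cross_def)
  have b: "?E 0 (m + 1 + i)" if "i \<in> {1..m}" for i
    using that by (auto simp: gadget_adj_def gadget_cross_def)
  \<comment> \<open>Only the pairs with \<open>i = j\<close> need the covering assumption:
    \<open>0\<close> or \<open>m + 1\<close> is then a common neighbour.\<close>
  have ab: "?P i (m + 1 + j)" if "i \<in> {1..m}" "j \<in> {1..m}" for i j
  proof -
    have "i \<in> X \<union> Y"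
      using cover that(1) by blast
    then consider "i \<noteq> j" | "i = j" "i \<in> X" | "i = j" "i \<in> Y"
      by blast
    then show ?thesis
    proof cases
      case 1
      then have "?E i (2 * m + 1 + i)" "?E (2 * m + 1 + i) (m + 1 + j)"
        using that by (auto simp: gadget_adj_def gadget_cross_def)
      then show ?thesis
        using that n by (intro exI[of _ "2 * m + 1 + i"]) auto
    next
      case 2
      then have "?E i 0"
        using that by (auto simp: gadget_adj_def gadget_cross_def)
      then show ?thesis
        using b that n by (intro exI[of _ 0]) auto
    next
      case 3
      then have "?E i (m + 1)" "?E (m + 1) (m + 1 + j)"
        using that by (auto simp: gadget_adj_def gadget_cross_def)
      then show ?thesis
        using that n by (intro exI[of _ "m + 1"]) auto
    qed
  qed
  have vertex: "u \<in> K \<or> u \<in> {1..m} \<or> (\<exists>i\<in>{1..m}. u = m + 1 + i)" if "u < n" for u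
  proof -
    have "u = m + 1 + (u - (m + 1))" "u - (m + 1) \<in> {1..m}" if "u \<in> {m + 2..2 * m + 1}"
      using that by auto
    moreover have "u \<in> K \<or> u \<in> {1..m} \<or> u \<in> {m + 2..2 * m + 1}"
      using \<open>u < n\<close> by (auto simp: K_def gadget_clique_def)
    ultimately show ?thesis
      by blast
  qed
  \<comment> \<open>Any clique vertex reaches every \<open>a\<^sub>i\<close> through
    \<open>m + 1\<close> and every \<open>b\<^sub>i\<close> through \<open>0\<close>.\<close>
  have KP: "?P u v" if "u \<in> K" "v < n" for u v
    using vertex[OF that(2)]
  proof (elim disjE bexE)
    assume "v \<in> K"
    with KK[OF that(1)] that(2) show ?thesis
      by blast
  next
    assume "v \<in> {1..m}"
    then show ?thesis
      using KK[OF that(1) K(2)] a K n by (intro exI[of _ "m + 1"]) auto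
  next
    fix i assume "i \<in> {1..m}" "v = m + 1 + i"
    then show ?thesis
      using KK[OF that(1) K(1)] b n by (intro exI[of _ 0]) auto
  qed
  have P: "?P u v" if "u < n" "v < n" for u v
  proof -
    have aa: "?P i j" if "i \<in> {1..m}" "j \<in> {1..m}" for i j
      using E_sym[OF a[OF that(1)]] a[OF that(2)] n by (intro exI[of _ "m + 1"] conjI) linarith+
    have bb: "?P (m + 1 + i) (m + 1 + j)" if "i \<in> {1..m}" "j \<in> {1..m}" for i j
      using E_sym[OF b[OF that(1)]] b[OF that(2)] n by (intro exI[of _ 0] conjI) linarith+
    show ?thesis
    proof (cases "u \<in> K \<or> v \<in> K")
      case True
      then show ?thesis
        using KP[OF _ that(2)] P_sym[OF KP[OF _ that(1)]] by blast
    next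
      case False
      with vertex[OF that(1)] vertex[OF that(2)] show ?thesis
        by (elim disjE bexE) (use aa bb ab P_sym[OF ab] in simp_all)
    qed
  qed
  show "\<exists>w\<in>pverts (gadget m n X Y). (u = w \<or> (u, w) \<in> parcs (gadget m n X Y)) \<and>
      (w = v \<or> (w, v) \<in> parcs (gadget m n X Y))"
    if "u \<in> pverts (gadget m n X Y)" "v \<in> pverts (gadget m n X Y)" for u v
    using P[of u v] that by auto
  show "pverts (gadget m n X Y) \<noteq> {}"
    using n by (auto simp: lessThan_empty_iff)
qed (rule pair_graph_gadget)

text \<open>An uncovered \<open>i\<close> leaves \<open>a\<^sub>i\<close> with only the neighbours
  \<open>m + 1\<close> and \<open>2 * m + 1 + i\<close>, neither of which is adjacent to
  \<open>b\<^sub>i\<close>.\<close>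

lemma gadget_diameter_gt_2:
  assumes "3 * m + 2 \<le> n" "i \<in> {1..m}" "i \<notin> X" "i \<notin> Y"
  shows "graph_diameter (gadget m n X Y) > 2"
proof (rule graph_diameter_gt_2[where s = i and t = "m + 1 + i"])
  show "(i, w) \<in> parcs (gadget m n X Y) \<Longrightarrow> (w, m + 1 + i) \<notin> parcs (gadget m n X Y)" for w
    using assms by (auto simp: gadget_adj_def gadget_cross_def gadget_clique_def)
  show "(i, m + 1 + i) \<notin> parcs (gadget m n X Y)"
    using assms by (auto simp: gadget_adj_def gadget_cross_def gadget_clique_def)
qed (use assms pair_graph_gadget in auto)

section \<open>From the fooling set to the memory bound\<close>

lemma gadget_memory_bound:
  assumes n: "3 * m + 2 \<le> n"
    and correct: "\<And>X Y. alg_output A p (gadget_stream m n X Y) = graph_diameter (gadget m n X Y)"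
  shows "\<exists>S. m \<le> 4 * (memory_used A p (gadget_stream m n S (- S)) * p)"
proof -
  define F where "F = Pow {1..m}"
  define mem where "mem S = memory_used A p (gadget_stream m n S (- S))" for S
  define M where "M = Max (mem ` F)"
  have fin: "finite (mem ` F)"
    by (simp add: F_def)
  \<comment> \<open>The maximum is attained, which yields one concrete input with large
    memory.\<close>
  have "M \<in> mem ` F"
    unfolding M_def using fin by (rule Max_in) (auto simp: F_def)
  then obtain S where S: "M = mem S"
    by blast
  have small: "\<not> 2 < alg_output A p (gadget_stream m n T (- T))" for T
    using gadget_diameter_le_2[OF n, of T "- T"] by (simp add: correct not_less)
  have big: "2 < alg_output A p (gadget_stream m n T (- U))"
    if "i \<in> {1..m}" "i \<notin> T" "i \<in> U" for i T U
    using gadget_diameter_gt_2[OF n] that by (simp add: correct)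
  have "card F \<le> 16 ^ (M * p)"
  proof (rule card_fooling_set_le[where \<tau> = "\<lambda>S. gadget_stream m n S (- S)" and h = "m + 1"])
    fix T t assume "T \<in> F" "t \<le> p * n"
    then have "length (memory_at A (gadget_stream m n T (- T)) t) \<le> mem T"
      unfolding mem_def by (intro length_memory_at_le_memory_used) simp
    also have "\<dots> \<le> M"
      unfolding M_def using fin \<open>T \<in> F\<close> by (intro Max_ge) auto
    finally show "length (memory_at A (gadget_stream m n T (- T)) t) \<le> M" .
  next
    fix T U assume "T \<in> F" "U \<in> F" "T \<noteq> U"
    \<comment> \<open>If \<open>i\<close> lies in \<open>U\<close> but not in \<open>T\<close>, it
      is uncovered by \<open>T\<close> and \<open>- U\<close>; in the other case the roles are
      swapped.\<close>
    then obtain i where "i \<in> {1..m}" "i \<notin> T \<and> i \<in> U \<or> i \<notin> U \<and> i \<in> T"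
      unfolding F_def by blast
    then show "alg_output A p (take (m + 1) (gadget_stream m n T (- T)) @
          drop (m + 1) (gadget_stream m n U (- U))) \<noteq> alg_output A p (gadget_stream m n U (- U)) \<or>
        alg_output A p (take (m + 1) (gadget_stream m n U (- U)) @
          drop (m + 1) (gadget_stream m n T (- T))) \<noteq> alg_output A p (gadget_stream m n T (- T))"
      unfolding gadget_stream_glue using big small by metis
  qed (use n in auto)
  then have "(2 :: nat) ^ m \<le> (2 ^ 4) ^ (M * p)"
    by (simp add: F_def card_Pow)
  then have "(2 :: nat) ^ m \<le> 2 ^ (4 * (M * p))"
    by (simp only: power_mult)
  then have "m \<le> 4 * (M * p)"
    by (rule power_le_imp_le_exp[rotated]) simp
  then show ?thesis
    using S mem_def by auto
qed

theorem theorem25: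
  shows "\<exists>c::real. c > 0 \<and> (\<exists>N::nat. \<forall>n\<ge>N. \<forall>p\<ge>1.
    \<forall>(\<F> :: nat pair_pre_digraph set) (A :: stream_alg).
      (\<forall>G\<in>\<F>. pair_graph G) \<longrightarrow>
      (\<forall>G. split_graph G \<longrightarrow> G \<in> \<F>) \<longrightarrow>
      solves_diameter A p \<F> n \<longrightarrow>
      (\<exists>G\<in>\<F>. pverts G = {..<n} \<and>
         (\<exists>\<sigma>. al_stream G \<sigma> \<and> real (memory_used A p \<sigma>) \<ge> c * (real n / real p))))"
proof (intro exI[of _ "1 / 24 :: real"] conjI exI[of _ "8 :: nat"] allI impI)
  fix n p :: nat and \<F> :: "nat pair_pre_digraph set" and A :: stream_alg
  assume "8 \<le> n" "1 \<le> p" and split: "\<forall>G. split_graph G \<longrightarrow> G \<in> \<F>"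
    and solves: "solves_diameter A p \<F> n"
  \<comment> \<open>The largest \<open>m\<close> for which the gadget fits. From
    \<open>n = 8\<close> on, \<open>n \<le> 6 * m\<close>; with the factor 4 from
    \<open>16 = 2 ^ 4\<close> this gives the constant \<open>1 / 24\<close>.\<close>
  define m where "m = (n - 2) div 3"
  have n: "3 * m + 2 \<le> n" "n \<le> 6 * m"
    using \<open>8 \<le> n\<close> unfolding m_def by linarith+
  have gadget: "gadget m n X Y \<in> \<F>" for X Y
    using split split_graph_gadget[OF n(1)] by blast
  have "alg_output A p (gadget_stream m n X Y) = graph_diameter (gadget m n X Y)" for X Y
    using solves gadget[of X Y] al_stream_gadget[of m n X Y] by (auto simp: solves_diameter_def)
  then obtain S where "m \<le> 4 * (memory_used A p (gadget_stream m n S (- S)) * p)"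
    using gadget_memory_bound[OF n(1)] by blast
  with n(2) have "n \<le> 24 * (memory_used A p (gadget_stream m n S (- S)) * p)"
    by linarith
  then have "real n \<le> real (24 * (memory_used A p (gadget_stream m n S (- S)) * p))"
    by (rule of_nat_mono)
  then have "1 / 24 * (real n / real p) \<le> real (memory_used A p (gadget_stream m n S (- S)))"
    using \<open>1 \<le> p\<close> by (simp add: field_simps)
  then show "\<exists>G\<in>\<F>. pverts G = {..<n} \<and> (\<exists>\<sigma>. al_stream G \<sigma> \<and>
      1 / 24 * (real n / real p) \<le> real (memory_used A p \<sigma>))"
    using gadget[of S "- S"] al_stream_gadget[of m n S "- S"]
    by (intro bexI[of _ "gadget m n S (- S)"]) auto
qed simp

end
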